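(* Let $T>0$ and let $G\colon\mathbb{R}^{2n}\to[0,\infty)$ be a semi-symplectic G-function. Then there exist constants $C_1,C_2>0$, depending only on $G$ and $T$, such that for every $u\in\mathbf{W}^1_T\mathbf{L}^G([0,T],\mathbb{R}^{2n})$, $$\int_0^T\langle J\dot u,u\rangle\,dt\ \ge\ -C_1\int_0^TG(T\dot u)\,dt-C_2 .$$
   Context: $J=\begin{pmatrix}0&I_n\\-I_n&0\end{pmatrix}$. The convex conjugate of $G$ is $G^\star(v)=\sup_u\{\langle u,v\rangle-G(u)\}$. A G-function is a convex function $G\colon\mathbb{R}^m\to[0,\infty)$ with $G(u)=0\iff u=0$, $G(-u)=G(u)$, and $\lim_{|u|\to\infty}G(u)/|u|=\infty$. $G$ on $\mathbb{R}^{2n}$ is semi-symplectic if there are $K>0$, $C\ge0$ with $G^\star(Ju)\le G(Ku)+C$ for all $u\in\mathbb{R}^{2n}$. $\mathbf{L}^G([0,T],\mathbb{R}^{m})$ is the set of measurable $u\colon[0,T]\to\mathbb{R}^m$ with $\int_0^TG(\lambda u)\,dt<\infty$ for some $\lambda>0$. $\mathbf{W}^1_T\mathbf{L}^G$ is the space of absolutely continuous $u\in\mathbf{L}^G$ with $\dot u\in\mathbf{L}^G$ and $u(0)=u(T)$. The integral $\int_0^T G(T\dot u)\,dt$ may equal $+\infty$, in which case the inequality is trivially true. *)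

theory Defs
  imports "HOL-Analysis.Analysis"
begin

(* The space R^(2n) is rendered as (real^'n) x (real^'n), whose library norm and inner product
   are the Euclidean ones.  In these coordinates the block matrix ((0, I), (-I, 0)) acts by
   (x, y) |-> (y, -x). *)
definition sympl_J :: "(real ^ 'n) \<times> (real ^ 'n) \<Rightarrow> (real ^ 'n) \<times> (real ^ 'n)" where
  "sympl_J z = (snd z, - fst z)"

definition G_function :: "('a::euclidean_space \<Rightarrow> real) \<Rightarrow> bool" where
  "G_function G \<longleftrightarrow>
     convex_on UNIV G \<and>
     (\<forall>u. 0 \<le> G u) \<and>
     (\<forall>u. G u = 0 \<longleftrightarrow> u = 0) \<and>
     (\<forall>u. G (- u) = G u) \<and>
     filterlim (\<lambda>u. G u / norm u) at_top at_infinity"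

(* Extended-real valued, so that the supremum is meaningful for every G. *)
definition convex_conjugate :: "('a::euclidean_space \<Rightarrow> real) \<Rightarrow> 'a \<Rightarrow> ereal" where
  "convex_conjugate G v = (SUP u. ereal (u \<bullet> v - G u))"

definition semi_symplectic :: "((real ^ 'n) \<times> (real ^ 'n) \<Rightarrow> real) \<Rightarrow> bool" where
  "semi_symplectic G \<longleftrightarrow>
     (\<exists>K>0. \<exists>C\<ge>0. \<forall>u. convex_conjugate G (sympl_J u) \<le> ereal (G (K *\<^sub>R u) + C))"

(* The usual epsilon-delta definition: d ranges over the finite families of non-overlapping
   compact intervals K = [Inf K, Sup K] contained in [a, b]. *)
definition absolutely_continuous_on_interval ::
    "real \<Rightarrow> real \<Rightarrow> (real \<Rightarrow> 'a::euclidean_space) \<Rightarrow> bool" where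
  "absolutely_continuous_on_interval a b u \<longleftrightarrow>
     (\<forall>\<epsilon>>0. \<exists>\<delta>>0. \<forall>d S. d division_of S \<and> S \<subseteq> {a..b} \<and> (\<Sum>K\<in>d. Sup K - Inf K) < \<delta>
        \<longrightarrow> (\<Sum>K\<in>d. norm (u (Sup K) - u (Inf K))) < \<epsilon>)"

definition Orlicz_space :: "('a::euclidean_space \<Rightarrow> real) \<Rightarrow> real \<Rightarrow> (real \<Rightarrow> 'a) set" where
  "Orlicz_space G T =
     {u. u \<in> borel_measurable (lebesgue_on {0..T}) \<and>
         (\<exists>l>0. (\<integral>\<^sup>+ t. ennreal (G (l *\<^sub>R u t)) \<partial>lebesgue_on {0..T}) < \<infinity>)}"

(* An absolutely continuous function is differentiable almost everywhere; on the remaining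
   null set vector_derivative is an unspecified constant, which affects no integral below. *)
definition time_deriv :: "real \<Rightarrow> (real \<Rightarrow> 'a::euclidean_space) \<Rightarrow> real \<Rightarrow> 'a" where
  "time_deriv T u t = vector_derivative u (at t within {0..T})"

definition periodic_Orlicz_Sobolev ::
    "('a::euclidean_space \<Rightarrow> real) \<Rightarrow> real \<Rightarrow> (real \<Rightarrow> 'a) set" where
  "periodic_Orlicz_Sobolev G T =
     {u. absolutely_continuous_on_interval 0 T u \<and>
         u \<in> Orlicz_space G T \<and>
         time_deriv T u \<in> Orlicz_space G T \<and>
         u 0 = u T}"

end

theory Submission
  imports Defs
begin

text \<open>
  Let \<open>v = u'\<close> and \<open>w = u - u 0\<close>. An absolutely continuous function is the integral of its derivative,
  so \<open>v\<close> has integral zero by periodicity, \<open>u\<close> may be replaced by \<open>w\<close> in the pairing, and \<open>w t\<close> is the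
  average over \<open>[0, T]\<close> of \<open>T v\<close> cut off after time \<open>t\<close>. Jensen's inequality bounds \<open>G (w t)\<close> by the
  average of \<open>G (T v)\<close>. Fenchel's inequality and semi-symplecticity give the pointwise bound
  \<open>\<langle>J v, w\<rangle> \<ge> - (K / T) (G (T v) + G w + C)\<close>, which is then integrated.

  Differentiability almost everywhere is obtained from the Vitali covering theorem without passing
  to monotone functions; the fundamental theorem then follows from a gauge that traps the
  exceptional tags in an open set of small measure.
\<close>

section \<open>Increments over divisions\<close>

lemma sum_increment_division_interval:
  fixes f :: "real \<Rightarrow> 'a::real_normed_vector"
  assumes "a \<le> b" "d division_of {a..b}"
  shows "(\<Sum>K\<in>d. f (Sup K) - f (Inf K)) = f b - f a"
proof -
  have inj: "inj_on (\<lambda>K. (Inf K, K)) d"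
    by (auto simp: inj_on_def)
  \<comment> \<open>The telescoping identity speaks of tagged divisions; the left endpoint serves as
    a tag.\<close>
  have "(\<lambda>K. (Inf K, K)) ` d tagged_division_of {a..b}"
  proof (rule tagged_division_ofI)
    show "finite ((\<lambda>K. (Inf K, K)) ` d)"
      using assms(2) by auto
    show "\<Union>{K. \<exists>x. (x, K) \<in> (\<lambda>K. (Inf K, K)) ` d} = {a..b}"
      using division_ofD(6)[OF assms(2)] by (auto simp: image_iff)
    fix x K assume K: "(x, K) \<in> (\<lambda>K. (Inf K, K)) ` d"
    then have xK: "K \<in> d" "x = Inf K"
      by auto
    then obtain y z where "K = cbox y z" "K \<noteq> {}"
      using division_ofD(3,4)[OF assms(2)] by blast
    then show "x \<in> K" "\<exists>a b. K = cbox a b"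
      using xK by auto
    show "K \<subseteq> {a..b}"
      using K division_ofD(2)[OF assms(2)] by auto
    fix x' K' assume "(x', K') \<in> (\<lambda>K. (Inf K, K)) ` d" "(x, K) \<noteq> (x', K')"
    then show "interior K \<inter> interior K' = {}"
      using K division_ofD(5)[OF assms(2)] by auto
  qed
  from additive_tagged_division_1[OF assms(1) this, of f] show ?thesis
    by (simp add: sum.reindex[OF inj])
qed

text \<open>The same complementary intervals complete both divisions to divisions of one large
  interval. There the increments telescope, and the common part cancels. The total increment is thus
  a function of the set alone.\<close>

lemma sum_increment_division_unique:
  fixes f :: "real \<Rightarrow> 'a::real_normed_vector"
  assumes d: "d division_of S" and d': "d' division_of S"
  shows "(\<Sum>K\<in>d. f (Sup K) - f (Inf K)) = (\<Sum>K\<in>d'. f (Sup K) - f (Inf K))"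
proof -
  let ?h = "\<lambda>K. f (Sup K) - f (Inf K)"
  have "bounded S"
    using d elementary_bounded by blast
  then obtain a where a: "S \<subseteq> cbox (-a) a"
    using bounded_subset_cbox_symmetric by blast
  \<comment> \<open>For empty \<open>S\<close> the bound \<open>a\<close> may be negative; the
    maximum ensures \<open>-b \<le> b\<close>.\<close>
  define b where "b = max a 0"
  have S: "S \<subseteq> cbox (-b) b" and b: "-b \<le> b"
    using a by (auto simp: b_def)
  obtain q where q: "d \<subseteq> q" "q division_of cbox (-b) b"
    using partial_division_extend_interval[of d "-b" b] d S division_ofD(6)[OF d] by metis
  have fin: "finite q" "finite d" "finite d'"
    using q d d' by auto
  have out: "(q - d) division_of \<Union>(q - d)"
    using q(2) by (metis Diff_subset division_of_subset division_of_union_self)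
  have "interior S \<inter> interior (\<Union>(q - d)) = {}"
  proof (rule Int_interior_Union_intervals)
    fix L assume L: "L \<in> q - d"
    then show "\<exists>a b. L = cbox a b"
      using division_ofD(4)[OF q(2)] by blast
    have "interior L \<inter> interior (\<Union>d) = {}"
    proof (rule Int_interior_Union_intervals)
      fix K assume "K \<in> d"
      then show "\<exists>a b. K = cbox a b" "interior L \<inter> interior K = {}"
        using division_ofD(4)[OF d] division_ofD(5)[OF q(2), of L K] q(1) L by blast+
    qed (use fin in auto)
    then show "interior S \<inter> interior L = {}"
      using division_ofD(6)[OF d] by auto
  qed (use fin in auto)
  then have disj: "interior (\<Union>(q - d)) \<inter> interior S = {}"
    by blast
  have "\<Union>(q - d) \<union> S = cbox (-b) b"
    using division_ofD(6)[OF d] division_ofD(6)[OF q(2)] q(1) by blast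
  then have "(q - d) \<union> d' division_of cbox (-b) b"
    using division_disjoint_union[OF out d' disj] by simp
  then have "sum ?h q = sum ?h ((q - d) \<union> d')"
    using sum_increment_division_interval[OF b, of _ f] q(2) by (metis box_real(2))
  also have "\<dots> = sum ?h (q - d) + sum ?h d'"
  proof -
    \<comment> \<open>The complement and \<open>d'\<close> can only share single points, whose
      increment is zero.\<close>
    have "?h K = 0" if K: "K \<in> (q - d) \<inter> d'" for K
    proof -
      have "interior K \<subseteq> interior (\<Union>(q - d))" "interior K \<subseteq> interior S"
        using K division_ofD(2)[OF d', of K] by (auto intro!: interior_mono)
      then have "interior K = {}"
        using disj by auto
      moreover obtain y z where "K = {y..z}" "K \<noteq> {}"
        using K division_ofD(3,4)[OF d'] by (metis IntD2 box_real(2))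
      ultimately show ?thesis
        by auto
    qed
    then have "sum ?h ((q - d) \<inter> d') = 0"
      by (rule sum.neutral[OF ballI])
    then show ?thesis
      using sum.union_inter[of "q - d" d' ?h] fin by simp
  qed
  finally show ?thesis
    using sum.subset_diff[OF q(1) fin(1), of ?h] by simp
qed

text \<open>Translates the smallness condition in absolute continuity from sums of lengths to
  Lebesgue measure.\<close>

lemma sum_length_division_eq_measure:
  fixes S :: "real set"
  assumes "d division_of S"
  shows "(\<Sum>K\<in>d. Sup K - Inf K) = measure lebesgue S"
proof -
  have "measure lebesgue (\<Union>d) = (\<Sum>K\<in>d. measure lebesgue K)"
  proof (rule measure_negligible_finite_Union)
    show "K \<in> lmeasurable" if "K \<in> d" for K
      using division_ofD(4)[OF assms that] by auto
    have "negligible (K \<inter> L)" if "K \<in> d" "L \<in> d" "K \<noteq> L" for K L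
    proof -
      have "convex (K \<inter> L)"
        using division_ofD(4)[OF assms that(1)] division_ofD(4)[OF assms that(2)]
        by (auto intro!: convex_Int)
      then show ?thesis
        using division_ofD(5)[OF assms that] by (simp add: negligible_convex_interior)
    qed
    then show "pairwise (\<lambda>S T. negligible (S \<inter> T)) d"
      by (auto simp: pairwise_def)
  qed (use assms in auto)
  moreover have "Sup K - Inf K = measure lebesgue K" if K: "K \<in> d" for K
  proof -
    obtain y z where "K = {y..z}" "K \<noteq> {}"
      using K division_ofD(3,4)[OF assms] by (metis box_real(2))
    then show ?thesis by auto
  qed
  ultimately show ?thesis
    using division_ofD(6)[OF assms] by simp
qed

lemma division_lmeasurable:
  assumes "d division_of S"
  shows "S \<in> lmeasurable"
  using division_ofD(1,4,6)[OF assms]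
  by (metis compact_Union compact_cbox lmeasurable_compact)

text \<open>Both divisions extend to divisions of \<open>S \<union> S'\<close>, which have equal
  total increments. The intervals added to either one have total length below
  \<open>\<delta>\<close>, so each extension costs less than \<open>\<eta>\<close>.\<close>

lemma division_increments_close:
  fixes f :: "real \<Rightarrow> 'a::real_normed_vector"
  assumes small: "\<And>d S. \<lbrakk>d division_of S; S \<subseteq> {a..b}; (\<Sum>K\<in>d. Sup K - Inf K) < \<delta>\<rbrakk>
                      \<Longrightarrow> (\<Sum>K\<in>d. norm (f (Sup K) - f (Inf K))) < \<eta>"
    and d: "d division_of S" "S \<subseteq> {a..b}" and d': "d' division_of S'" "S' \<subseteq> {a..b}"
    and "measure lebesgue (S' - S) < \<delta>" "measure lebesgue (S - S') < \<delta>"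
  shows "norm ((\<Sum>K\<in>d. f (Sup K) - f (Inf K)) - (\<Sum>K\<in>d'. f (Sup K) - f (Inf K))) < 2 * \<eta>"
proof -
  let ?h = "\<lambda>K. f (Sup K) - f (Inf K)"
  obtain q where q: "q division_of S \<union> S'"
    using elementary_union d(1) d'(1) by meson
  \<comment> \<open>Used for \<open>c = d\<close> and \<open>c = d'\<close>. The extension
    \<open>r\<close> depends on \<open>c\<close>, but its increments sum to those of the fixed
    reference division \<open>q\<close>.\<close>
  have half: "norm (sum ?h q - sum ?h c) < \<eta>"
    if c: "c division_of U" "U \<subseteq> S \<union> S'" and small_diff: "measure lebesgue (S \<union> S' - U) < \<delta>"
    for c U
  proof -
    obtain r where r: "c \<subseteq> r" "r division_of S \<union> S'"
      using partial_division_extend[OF c(1) q c(2)] by blast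
    have fin: "finite r" using r by auto
    have rest: "(r - c) division_of \<Union>(r - c)"
      using r(2) by (metis Diff_subset division_of_subset division_of_union_self)
    have "(\<Sum>K\<in>r - c. Sup K - Inf K) = measure lebesgue (S \<union> S') - measure lebesgue U"
      using sum.subset_diff[OF r(1) fin, of "\<lambda>K. Sup K - Inf K"]
        sum_length_division_eq_measure[OF c(1)] sum_length_division_eq_measure[OF r(2)] by linarith
    also have "\<dots> = measure lebesgue (S \<union> S' - U)"
      using measurable_measure_Diff[of "S \<union> S'" lebesgue U] division_lmeasurable[OF c(1)]
        division_lmeasurable[OF q] c(2) by (simp add: fmeasurableD)
    finally have "(\<Sum>K\<in>r - c. norm (?h K)) < \<eta>"
      using small_diff d(2) d'(2) division_ofD(6)[OF r(2)] by (intro small[OF rest]) auto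
    moreover have "sum ?h q = sum ?h r"
      by (rule sum_increment_division_unique[OF q r(2)])
    then have "sum ?h q - sum ?h c = sum ?h (r - c)"
      using sum.subset_diff[OF r(1) fin, of ?h] by simp
    ultimately show ?thesis
      using norm_sum[of ?h "r - c"] by simp
  qed
  have "norm (sum ?h q - sum ?h d) < \<eta>" "norm (sum ?h q - sum ?h d') < \<eta>"
    using half[OF d(1)] half[OF d'(1)] assms(6,7) by (auto simp: Un_Diff)
  moreover have "norm (sum ?h d - sum ?h d')
      \<le> norm (sum ?h q - sum ?h d') + norm (sum ?h q - sum ?h d)"
    using norm_triangle_ineq4[of "sum ?h q - sum ?h d'" "sum ?h q - sum ?h d"] by simp
  ultimately show ?thesis
    by simp
qed

section \<open>Finite divisions from Vitali coverings\<close>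

text \<open>The Vitali theorem selects countably many disjoint intervals that cover \<open>E\<close>
  up to a null set; since all of them lie in \<open>U\<close>, of finite measure, finitely many
  already miss less than \<open>e\<close>.\<close>

lemma Vitali_interval_division:
  fixes E :: "real set"
  assumes E: "E \<in> sets lebesgue" "E \<subseteq> U" and U: "open U" "U \<in> lmeasurable"
    and cover: "\<And>x d. \<lbrakk>x \<in> E; 0 < d\<rbrakk> \<Longrightarrow> \<exists>y z. y < x \<and> x < z \<and> z - y < d \<and> P y z"
    and "0 < e"
  obtains D S where "D division_of S" "S \<subseteq> U" "measure lebesgue (E - S) < e"
    "\<And>K. K \<in> D \<Longrightarrow> \<exists>y z. y < z \<and> K = {y..z} \<and> P y z"
proof -
  define I where "I = {(y, z). y < z \<and> P y z \<and> {y..z} \<subseteq> U}"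
  \<comment> \<open>A compact interval is the closed ball about its midpoint, the form in which the
    covering theorem takes it. The covered point need not be the centre.\<close>
  define mid where "mid = (\<lambda>(y, z). (y + z) / 2 :: real)"
  define rad where "rad = (\<lambda>(y, z). (z - y) / 2 :: real)"
  have cball: "cball (mid i) (rad i) = {fst i..snd i}" if "fst i < snd i" for i
    using that by (cases i) (simp add: mid_def rad_def cball_eq_atLeastAtMost field_simps)
  have pos: "0 < rad i" "fst i < snd i" if "i \<in> I" for i
    using that by (auto simp: I_def rad_def)
  have fine: "\<exists>i. i \<in> I \<and> x \<in> cball (mid i) (rad i) \<and> rad i < d" if "x \<in> E" "0 < d" for x d
  proof -
    obtain r where r: "0 < r" "ball x r \<subseteq> U"
      using U(1) E(2) \<open>x \<in> E\<close> by (meson open_contains_ball subsetD)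
    obtain y z where yz: "y < x" "x < z" "z - y < min r d" "P y z"
      using cover[OF \<open>x \<in> E\<close>, of "min r d"] r \<open>0 < d\<close> by auto
    have "{y..z} \<subseteq> ball x r"
      using yz by (auto simp: ball_def dist_real_def)
    then have "(y, z) \<in> I"
      using yz r by (auto simp: I_def)
    then show ?thesis
      using yz by (intro exI[of _ "(y, z)"]) (simp add: cball, simp add: rad_def)
  qed
  obtain C where C: "countable C" "C \<subseteq> I"
      "pairwise (\<lambda>i j. disjnt (cball (mid i) (rad i)) (cball (mid j) (rad j))) C"
      "negligible (E - (\<Union>i\<in>C. cball (mid i) (rad i)))"
    by (rule Vitali_covering_theorem_cballs[of I rad E mid, OF pos(1) fine])
  let ?B = "\<lambda>i. cball (mid i) (rad i)"
  have sub: "?B i \<subseteq> U" "?B i \<in> lmeasurable" if "i \<in> C" for i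
  proof -
    have "i \<in> I"
      using that C(2) by blast
    then show "?B i \<subseteq> U" "?B i \<in> lmeasurable"
      using cball[OF pos(2)] by (auto simp: I_def)
  qed
  have UC: "\<Union>(?B ` C) \<in> lmeasurable"
    
  proof (rule fmeasurableI2[OF U(2)])
    show "\<Union>(?B ` C) \<in> sets lebesgue"
      using sub(2) C(1) by (intro sets.countable_UN'') auto
  qed (use sub(1) in blast)
  have fin_sub: "\<Union>D \<in> lmeasurable" "\<Union>D \<subseteq> U" if "D \<subseteq> ?B ` C" "finite D" for D
    using that sub(2) by (auto intro!: fmeasurable.finite_Union dest!: subsetD[OF that(1)] subsetD[OF sub(1)])
  obtain D where D: "D \<subseteq> ?B ` C" "finite D"
      "measure lebesgue (\<Union>(?B ` C)) - e < measure lebesgue (\<Union>D)"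
  proof (rule measure_countable_Union_approachable[of "?B ` C" e "measure lebesgue U"])
    fix D' assume D': "D' \<subseteq> ?B ` C" "finite D'"
    then show "measure lebesgue (\<Union>D') \<le> measure lebesgue U"
      using fin_sub by (intro measure_mono_fmeasurable U) (auto intro: fmeasurableD)
  qed (use C sub \<open>0 < e\<close> in auto)
  have form: "\<exists>y z. y < z \<and> K = {y..z} \<and> P y z" if K: "K \<in> D" for K
  proof -
    obtain i where i: "i \<in> C" "K = ?B i"
      using K D(1) by blast
    then have "i \<in> I" using C by auto
    then show ?thesis
      using cball[OF pos(2), of i] i by (intro exI[of _ "fst i"] exI[of _ "snd i"]) (auto simp: I_def)
  qed
  show thesis
  proof
    show "D division_of \<Union>D"
    proof (rule division_ofI)
      fix K assume K: "K \<in> D"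
      show "K \<noteq> {}" "\<exists>a b. K = cbox a b"
        using form[OF K] by auto
      fix L assume L: "L \<in> D" "K \<noteq> L"
      obtain i j where ij: "i \<in> C" "j \<in> C" "K = ?B i" "L = ?B j"
        using K L(1) D(1) by blast
      then have "K \<inter> L = {}"
        using pairwiseD[OF C(3) ij(1,2)] L(2) unfolding disjnt_def by blast
      then show "interior K \<inter> interior L = {}"
        using interior_subset by blast
    qed (use D in auto)
    show "\<Union>D \<subseteq> U"
      using D fin_sub by blast
    have Dm: "\<Union>D \<in> lmeasurable"
      using D fin_sub by blast
    have pieces: "E - \<Union>(?B ` C) \<in> lmeasurable" "\<Union>(?B ` C) - \<Union>D \<in> lmeasurable"
      using C(4) UC Dm by (auto simp: negligible_imp_measurable intro!: fmeasurable.Diff)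
    \<comment> \<open>The missed part splits into the null set left by the countable family and what
      the finite selection drops.\<close>
    have "measure lebesgue (E - \<Union>D)
        \<le> measure lebesgue ((E - \<Union>(?B ` C)) \<union> (\<Union>(?B ` C) - \<Union>D))"
      using Dm pieces E by (intro measure_mono_fmeasurable fmeasurable.Un) auto
    also have "\<dots> \<le> measure lebesgue (E - \<Union>(?B ` C)) + measure lebesgue (\<Union>(?B ` C) - \<Union>D)"
      using pieces by (intro measure_Un_le) (auto intro: fmeasurableD)
    also have "measure lebesgue (E - \<Union>(?B ` C)) = 0"
      using C(4) by (rule negligible_imp_measure0)
    also have "measure lebesgue (\<Union>(?B ` C) - \<Union>D) = measure lebesgue (\<Union>(?B ` C)) - measure lebesgue (\<Union>D)"
      using Dm UC D(1) by (intro measurable_measure_Diff) (auto simp: fmeasurableD)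
    finally show "measure lebesgue (E - \<Union>D) < e"
      using D(3) by simp
  qed (use form in auto)
qed

section \<open>Absolutely continuous functions\<close>

text \<open>The points with a fine cover by intervals of slope greater than \<open>q\<close>. The intervals are
  two-sided, which makes this set a countable intersection of open sets.\<close>

definition steep :: "(real \<Rightarrow> real) \<Rightarrow> real \<Rightarrow> real set" where
  "steep f q = {x. \<forall>d>0. \<exists>y z. y < x \<and> x < z \<and> z - y < d \<and> q * (z - y) < f z - f y}"

lemma borel_steep: "steep f q \<in> sets borel"
proof -
  define A where "A d = (\<Union>(y, z) \<in> {(y, z). z - y < d \<and> q * (z - y) < f z - f y}. {y<..<z})" for d
  have mem_A: "x \<in> A d \<longleftrightarrow> (\<exists>y z. y < x \<and> x < z \<and> z - y < d \<and> q * (z - y) < f z - f y)" for x d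
    unfolding A_def by auto
  have "x \<in> A d" if "\<And>n. x \<in> A (1 / Suc n)" "d > 0" for x d
  proof -
    obtain n where "1 / Suc n < d"
      using nat_approx_posE[OF \<open>d > 0\<close>] by blast
    then show ?thesis
      using that(1)[of n] unfolding mem_A by (meson less_trans)
  qed
  moreover have "x \<in> steep f q \<longleftrightarrow> (\<forall>d>0. x \<in> A d)" for x
    unfolding steep_def mem_A by simp
  moreover have "0 < 1 / real (Suc n)" for n
    by simp
  ultimately have "x \<in> steep f q \<longleftrightarrow> (\<forall>n. x \<in> A (1 / Suc n))" for x
    by blast
  then have "steep f q = (\<Inter>n. A (1 / Suc n))"
    by blast
  moreover have "A d \<in> sets borel" for d
    unfolding A_def by (intro borel_open open_UN) auto
  ultimately show ?thesis
    by simp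
qed

section \<open>Elementary consequences of absolute continuity\<close>

lemma absolutely_continuous_on_intervalE:
  assumes "absolutely_continuous_on_interval a b f" "0 < \<epsilon>"
  obtains \<delta> where "0 < \<delta>"
    "\<And>d S. \<lbrakk>d division_of S; S \<subseteq> {a..b}; (\<Sum>K\<in>d. Sup K - Inf K) < \<delta>\<rbrakk>
       \<Longrightarrow> (\<Sum>K\<in>d. norm (f (Sup K) - f (Inf K))) < \<epsilon>"
proof -
  obtain \<delta> where \<delta>: "0 < \<delta>"
    "\<forall>d S. d division_of S \<and> S \<subseteq> {a..b} \<and> (\<Sum>K\<in>d. Sup K - Inf K) < \<delta>
       \<longrightarrow> (\<Sum>K\<in>d. norm (f (Sup K) - f (Inf K))) < \<epsilon>"
    using assms unfolding absolutely_continuous_on_interval_def by meson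
  show thesis
    by (rule that[OF \<delta>(1)]) (use \<delta>(2) in blast)
qed

lemma absolutely_continuous_on_interval_minus:
  assumes "absolutely_continuous_on_interval a b f"
  shows "absolutely_continuous_on_interval a b (\<lambda>x. - f x)"
  using assms by (simp only: absolutely_continuous_on_interval_def minus_diff_minus norm_minus_cancel)

lemma absolutely_continuous_on_interval_inner:
  assumes f: "absolutely_continuous_on_interval a b f" and c: "c \<in> Basis"
  shows "absolutely_continuous_on_interval a b (\<lambda>x. f x \<bullet> c)"
  unfolding absolutely_continuous_on_interval_def
proof (intro allI impI)
  fix \<epsilon> :: real assume "0 < \<epsilon>"
  then obtain \<delta> where \<delta>: "0 < \<delta>"
    "\<And>d S. \<lbrakk>d division_of S; S \<subseteq> {a..b}; (\<Sum>K\<in>d. Sup K - Inf K) < \<delta>\<rbrakk>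
       \<Longrightarrow> (\<Sum>K\<in>d. norm (f (Sup K) - f (Inf K))) < \<epsilon>"
    using absolutely_continuous_on_intervalE[OF f] by blast
  have "(\<Sum>K\<in>d. norm (f (Sup K) \<bullet> c - f (Inf K) \<bullet> c)) \<le> (\<Sum>K\<in>d. norm (f (Sup K) - f (Inf K)))" for d
    using Basis_le_norm[OF c] by (intro sum_mono) (metis inner_diff_left real_norm_def)
  then show "\<exists>\<delta>>0. \<forall>d S. d division_of S \<and> S \<subseteq> {a..b} \<and> (\<Sum>K\<in>d. Sup K - Inf K) < \<delta> \<longrightarrow>
      (\<Sum>K\<in>d. norm (f (Sup K) \<bullet> c - f (Inf K) \<bullet> c)) < \<epsilon>"
    using \<delta> by (meson le_less_trans)
qed

lemma absolutely_continuous_imp_continuous_on: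
  assumes f: "absolutely_continuous_on_interval a b f"
  shows "continuous_on {a..b} f"
  unfolding continuous_on_iff
proof (intro ballI allI impI)
  fix x \<epsilon> :: real assume x: "x \<in> {a..b}" and "0 < \<epsilon>"
  then obtain \<delta> where \<delta>: "0 < \<delta>"
    "\<And>d S. \<lbrakk>d division_of S; S \<subseteq> {a..b}; (\<Sum>K\<in>d. Sup K - Inf K) < \<delta>\<rbrakk>
       \<Longrightarrow> (\<Sum>K\<in>d. norm (f (Sup K) - f (Inf K))) < \<epsilon>"
    using absolutely_continuous_on_intervalE[OF f] by blast
  \<comment> \<open>Divisions consisting of one interval already give uniform continuity.\<close>
  have close: "dist (f z) (f y) < \<epsilon>" if "y \<le> z" "z - y < \<delta>" "y \<in> {a..b}" "z \<in> {a..b}" for y z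
    using \<delta>(2)[of "{{y..z}}" "{y..z}"] division_of_self[of y z] that by (simp add: dist_norm)
  have "dist (f y) (f x) < \<epsilon>" if "y \<in> {a..b}" "dist y x < \<delta>" for y
    using close[of x y] close[of y x] x that by (cases "x \<le> y") (auto simp: dist_real_def dist_commute)
  then show "\<exists>d>0. \<forall>x'\<in>{a..b}. dist x' x < d \<longrightarrow> dist (f x') (f x) < \<epsilon>"
    using \<delta>(1) by blast
qed

section \<open>Null sets of steep points\<close>

text \<open>Steepness provides the fine cover for Vitali, and over the selected intervals the slope
  inequalities add up. Upper bounds on increments come from applying this to
  \<open>- f\<close>.\<close>

lemma steep_division:
  assumes E: "E \<in> sets lebesgue" "E \<subseteq> U" "E \<subseteq> steep f q" and U: "open U" "U \<in> lmeasurable" and "0 < e"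
  obtains D S where "D division_of S" "S \<subseteq> U" "measure lebesgue (E - S) < e"
    "q * measure lebesgue S \<le> (\<Sum>K\<in>D. f (Sup K) - f (Inf K))"
proof -
  have "\<exists>y z. y < x \<and> x < z \<and> z - y < d \<and> q * (z - y) < f z - f y" if "x \<in> E" "0 < d" for x d
    using E(3) that by (auto simp: steep_def)
  then obtain D S where D: "D division_of S" "S \<subseteq> U" "measure lebesgue (E - S) < e"
      and K: "\<And>K. K \<in> D \<Longrightarrow> \<exists>y z. y < z \<and> K = {y..z} \<and> q * (z - y) < f z - f y"
    using Vitali_interval_division[OF E(1,2) U, of "\<lambda>y z. q * (z - y) < f z - f y" e] \<open>0 < e\<close> by blast
  have "q * measure lebesgue S = (\<Sum>K\<in>D. q * (Sup K - Inf K))"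
    by (simp add: sum_length_division_eq_measure[OF D(1), symmetric] sum_distrib_left)
  also have "\<dots> \<le> (\<Sum>K\<in>D. f (Sup K) - f (Inf K))"
    using K by (intro sum_mono) fastforce
  finally show thesis
    using that D by blast
qed

text \<open>Cover the set by Vitali up to a small error, once by intervals of slope above \<open>q\<close> and once by
  intervals of slope below \<open>p\<close>. The two families occupy almost the same set, so by absolute
  continuity their total increments almost agree.\<close>

lemma negligible_upper_lower_steep:
  assumes f: "absolutely_continuous_on_interval a b f" and "p < q"
  shows "negligible ({a<..<b} \<inter> steep f q \<inter> steep (\<lambda>x. - f x) (- p))" (is "negligible ?E")
proof -
  let ?m = "measure lebesgue"
  have E: "?E \<in> sets lebesgue"
    using borel_steep by auto
  have Em: "?E \<in> lmeasurable"
    by (rule fmeasurableI2[OF _ _ E, of "{a<..<b}"]) auto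
  \<comment> \<open>The constant collects \<open>2 * \<eta>\<close> from comparing the increments of
    the two families, and \<open>\<bar>q\<bar> * \<eta>\<close> and
    \<open>\<bar>p\<bar> * \<eta>\<close> from replacing the measures of \<open>S\<close> and
    \<open>S'\<close> by that of the exceptional set.\<close>
  have key: "(q - p) * ?m ?E \<le> (2 + \<bar>p\<bar> + \<bar>q\<bar>) * \<eta>" if "0 < \<eta>" for \<eta>
  proof -
    obtain \<delta>0 where "0 < \<delta>0" and \<delta>0: "\<And>d S. \<lbrakk>d division_of S; S \<subseteq> {a..b}; (\<Sum>K\<in>d. Sup K - Inf K) < \<delta>0\<rbrakk>
       \<Longrightarrow> (\<Sum>K\<in>d. norm (f (Sup K) - f (Inf K))) < \<eta>"
      using absolutely_continuous_on_intervalE[OF f \<open>0 < \<eta>\<close>] by blast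
    \<comment> \<open>Each family leaves less than \<open>2 * \<delta>\<close> of \<open>U\<close>
      uncovered, which must stay within \<open>\<delta>0\<close>; the minimum with
      \<open>\<eta>\<close> controls the errors in measure.\<close>
    define \<delta> where "\<delta> = min \<delta>0 \<eta> / 2"
    have "0 < \<delta>" "2 * \<delta> \<le> \<delta>0" "2 * \<delta> \<le> \<eta>"
      using \<open>0 < \<delta>0\<close> \<open>0 < \<eta>\<close> by (auto simp: \<delta>_def)
    obtain U0 where U0: "open U0" "?E \<subseteq> U0" "U0 - ?E \<in> lmeasurable" "emeasure lebesgue (U0 - ?E) < ennreal \<delta>"
      using sets_lebesgue_outer_open[OF E \<open>0 < \<delta>\<close>] by blast
    \<comment> \<open>The selected intervals have to stay in \<open>{a..b}\<close>, where absolute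
      continuity applies.\<close>
    define U where "U = U0 \<inter> {a<..<b}"
    have U: "open U" "U \<in> lmeasurable" "?E \<subseteq> U" "U \<subseteq> {a..b}"
      using U0 by (auto simp: U_def intro!: bounded_set_imp_lmeasurable bounded_Int)
    have UE: "?m (U - ?E) < \<delta>"
    proof -
      have "?m (U - ?E) \<le> ?m (U0 - ?E)"
        using U0(3) U(2) E by (intro measure_mono_fmeasurable) (auto simp: U_def)
      also have "\<dots> < \<delta>"
        using U0(3,4) \<open>0 < \<delta>\<close> by (simp add: emeasure_eq_measure2 ennreal_less_iff)
      finally show ?thesis .
    qed
    obtain D S where D: "D division_of S" "S \<subseteq> U" "?m (?E - S) < \<delta>"
        "q * ?m S \<le> (\<Sum>K\<in>D. f (Sup K) - f (Inf K))"
      by (rule steep_division[OF E U(3) _ U(1,2) \<open>0 < \<delta>\<close>, of f q]) auto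
    obtain D' S' where D': "D' division_of S'" "S' \<subseteq> U" "?m (?E - S') < \<delta>"
        "- p * ?m S' \<le> (\<Sum>K\<in>D'. - f (Sup K) - - f (Inf K))"
      by (rule steep_division[OF E U(3) _ U(1,2) \<open>0 < \<delta>\<close>, of "\<lambda>x. - f x" "-p"]) auto
    have D'4: "(\<Sum>K\<in>D'. f (Sup K) - f (Inf K)) \<le> p * ?m S'"
    proof -
      have "(\<Sum>K\<in>D'. - f (Sup K) - - f (Inf K)) = - (\<Sum>K\<in>D'. f (Sup K) - f (Inf K))"
        by (simp add: sum_negf[symmetric])
      then show ?thesis using D'(4) by simp
    qed
    have rest: "?m (U - R) < 2 * \<delta>" "\<bar>?m R - ?m ?E\<bar> \<le> \<delta>"
      if R: "R \<in> lmeasurable" "R \<subseteq> U" "?m (?E - R) < \<delta>" for R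
    proof -
      have "?m (U - R) \<le> ?m ((U - ?E) \<union> (?E - R))"
        using U R Em by (intro measure_mono_fmeasurable) auto
      also have "\<dots> \<le> ?m (U - ?E) + ?m (?E - R)"
        using U R Em by (intro measure_Un_le) auto
      finally show "?m (U - R) < 2 * \<delta>"
        using UE R(3) by simp
      have "?m R \<le> ?m U"
        using U R by (intro measure_mono_fmeasurable) auto
      moreover have "?m (U - ?E) = ?m U - ?m ?E"
        using U E by (intro measurable_measure_Diff) auto
      moreover have "?m ?E \<le> ?m (R \<union> (?E - R))"
        using U R Em by (intro measure_mono_fmeasurable) auto
      moreover have "\<dots> \<le> ?m R + ?m (?E - R)"
        using U R Em by (intro measure_Un_le) auto
      ultimately show "\<bar>?m R - ?m ?E\<bar> \<le> \<delta>"
        using UE R(3) by linarith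
    qed
    note Sm = division_lmeasurable[OF D(1)] division_lmeasurable[OF D'(1)]
    have diff: "?m (S' - S) < \<delta>0" "?m (S - S') < \<delta>0"
    proof -
      have "?m (S' - S) \<le> ?m (U - S)" "?m (S - S') \<le> ?m (U - S')"
        using U Sm D(2) D'(2) by (auto intro!: measure_mono_fmeasurable)
      then show "?m (S' - S) < \<delta>0" "?m (S - S') < \<delta>0"
        using rest(1)[OF Sm(1) D(2,3)] rest(1)[OF Sm(2) D'(2,3)] \<open>2 * \<delta> \<le> \<delta>0\<close> by auto
    qed
    have "norm ((\<Sum>K\<in>D. f (Sup K) - f (Inf K)) - (\<Sum>K\<in>D'. f (Sup K) - f (Inf K))) < 2 * \<eta>"
      by (rule division_increments_close[OF \<delta>0 D(1) _ D'(1)]) (use diff D(2) D'(2) U(4) in auto)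
    then have "q * ?m S - p * ?m S' < 2 * \<eta>"
      using D(4) D'4 by (simp add: abs_less_iff)
    moreover have "\<bar>q * (?m S - ?m ?E)\<bar> \<le> \<bar>q\<bar> * \<eta>" "\<bar>p * (?m S' - ?m ?E)\<bar> \<le> \<bar>p\<bar> * \<eta>"
      using rest(2)[OF Sm(1) D(2,3)] rest(2)[OF Sm(2) D'(2,3)] \<open>2 * \<delta> \<le> \<eta>\<close> \<open>0 < \<delta>\<close>
      by (auto simp: abs_mult intro!: mult_left_mono)
    ultimately show ?thesis
      by (simp add: algebra_simps abs_le_iff)
  qed
  have "?m ?E \<le> e" if "0 < e" for e
  proof -
    have "0 < 2 + \<bar>p\<bar> + \<bar>q\<bar>" by simp
    then have "(q - p) * ?m ?E \<le> (q - p) * e"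
      using key[of "(q - p) * e / (2 + \<bar>p\<bar> + \<bar>q\<bar>)"] \<open>p < q\<close> \<open>0 < e\<close> by simp
    then show ?thesis
      using \<open>p < q\<close> by simp
  qed
  then have "?m ?E = 0"
    by (metis antisym field_le_epsilon add_0 measure_nonneg)
  then show ?thesis
    using Em by (simp add: negligible_iff_measure)
qed

text \<open>Negligibility is local, so it suffices to work in a neighbourhood \<open>U\<close> of
  length below \<open>\<delta>\<close>, where increments sum to less than 1. Intervals of slope
  above \<open>n\<close> almost cover the set inside \<open>U\<close>, so \<open>n\<close> times its
  measure is at most 1 up to a small error, for every \<open>n\<close>.\<close>

lemma negligible_infinitely_steep:
  assumes f: "absolutely_continuous_on_interval a b f"
  shows "negligible ({a<..<b} \<inter> (\<Inter>n::nat. steep f n))" (is "negligible ?E")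
  unfolding locally_negligible_alt[of ?E]
proof
  let ?m = "measure lebesgue"
  fix x assume x: "x \<in> ?E"
  have E: "?E \<in> sets lebesgue"
    using borel_steep by auto
  obtain \<delta> where "0 < \<delta>" and \<delta>: "\<And>d S. \<lbrakk>d division_of S; S \<subseteq> {a..b}; (\<Sum>K\<in>d. Sup K - Inf K) < \<delta>\<rbrakk>
     \<Longrightarrow> (\<Sum>K\<in>d. norm (f (Sup K) - f (Inf K))) < 1"
    using absolutely_continuous_on_intervalE[OF f, of 1] by auto
  \<comment> \<open>The length is at most \<open>2 * \<delta> / 3\<close>, strictly below
    \<open>\<delta>\<close>.\<close>
  define U where "U = {a<..<b} \<inter> {x - \<delta> / 3<..<x + \<delta> / 3}"
  have U: "open U" "U \<in> lmeasurable" "U \<subseteq> {a..b}"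
    by (auto simp: U_def intro!: bounded_set_imp_lmeasurable bounded_Int)
  have mU: "?m U < \<delta>"
  proof -
    have "?m U \<le> ?m {x - \<delta> / 3<..<x + \<delta> / 3}"
      using U by (intro measure_mono_fmeasurable) (auto simp: U_def)
    then show ?thesis
      using \<open>0 < \<delta>\<close> by simp
  qed
  have EU: "?E \<inter> U \<in> sets lebesgue" "?E \<inter> U \<in> lmeasurable"
  proof -
    show EU: "?E \<inter> U \<in> sets lebesgue"
      by (rule sets.Int[OF E fmeasurableD[OF U(2)]])
    show "?E \<inter> U \<in> lmeasurable"
      by (rule fmeasurableI2[OF U(2) _ EU]) simp
  qed
  have bound: "real n * (?m (?E \<inter> U) - e) \<le> 1" if "0 < e" for n e
  proof -
    obtain D S where D: "D division_of S" "S \<subseteq> U" "?m ((?E \<inter> U) - S) < e"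
        "real n * ?m S \<le> (\<Sum>K\<in>D. f (Sup K) - f (Inf K))"
      by (rule steep_division[OF EU(1) _ _ U(1,2) \<open>0 < e\<close>, of f "real n"]) auto
    note Sm = division_lmeasurable[OF D(1)]
    have "?m S \<le> ?m U"
      using D(2) U Sm by (intro measure_mono_fmeasurable) auto
    then have "(\<Sum>K\<in>D. norm (f (Sup K) - f (Inf K))) < 1"
      using mU D(2) U(3) by (intro \<delta>[OF D(1)]) (auto simp: sum_length_division_eq_measure[OF D(1)])
    then have "real n * ?m S \<le> 1"
      using D(4) sum_abs[of "\<lambda>K. f (Sup K) - f (Inf K)" D] unfolding real_norm_def by linarith
    moreover have "?m (?E \<inter> U) \<le> ?m (S \<union> (?E \<inter> U - S))"
      using EU Sm by (intro measure_mono_fmeasurable) auto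
    moreover have "\<dots> \<le> ?m S + ?m (?E \<inter> U - S)"
      using EU Sm by (intro measure_Un_le) auto
    ultimately show ?thesis
      using D(3) mult_left_mono[of "?m (?E \<inter> U) - e" "?m S" "real n"] by simp
  qed
  have "?m (?E \<inter> U) = 0"
  proof (rule ccontr)
    assume "?m (?E \<inter> U) \<noteq> 0"
    then have pos: "0 < ?m (?E \<inter> U)"
      by (simp add: zero_less_measure_iff)
    obtain n where "2 < real n * ?m (?E \<inter> U)"
      using reals_Archimedean3[OF pos] by blast
    then show False
      using bound[of "?m (?E \<inter> U) / 2" n] pos by simp
  qed
  then have "negligible (?E \<inter> U)"
    using EU by (simp add: negligible_iff_measure)
  moreover have "openin (top_of_set ?E) (?E \<inter> U)" "x \<in> ?E \<inter> U"
    using U x \<open>0 < \<delta>\<close> by (auto simp: U_def openin_open)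
  ultimately show "\<exists>U. openin (top_of_set ?E) U \<and> x \<in> U \<and> negligible U"
    by blast
qed

section \<open>Differentiability almost everywhere\<close>

lemma not_steepD:
  assumes "x \<notin> steep f q"
  obtains d where "0 < d" "\<And>y z. \<lbrakk>y < x; x < z; z - y < d\<rbrakk> \<Longrightarrow> f z - f y \<le> q * (z - y)"
  using assms unfolding steep_def by (force simp: not_less)

text \<open>The hypotheses control slopes only over intervals with \<open>x\<close> strictly inside.
  Continuity at \<open>x\<close> lets one endpoint tend to \<open>x\<close>, which yields the
  one-sided difference quotients.\<close>

lemma has_real_derivative_if_not_steep:
  fixes f :: "real \<Rightarrow> real"
  assumes cont: "isCont f x"
    and above: "\<And>q. s < q \<Longrightarrow> x \<notin> steep f q"
    and below: "\<And>p. p < s \<Longrightarrow> x \<notin> steep (\<lambda>x. - f x) (- p)"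
  shows "(f has_real_derivative s) (at x)"
  unfolding has_field_derivative_def has_derivative_at_alt
proof (intro conjI allI impI)
  fix e :: real assume "0 < e"
  obtain d1 where d1: "0 < d1" "\<And>y z. \<lbrakk>y < x; x < z; z - y < d1\<rbrakk> \<Longrightarrow> f z - f y \<le> (s + e) * (z - y)"
    using not_steepD[OF above[of "s + e"]] \<open>0 < e\<close> by auto
  obtain d2 where d2: "0 < d2" "\<And>y z. \<lbrakk>y < x; x < z; z - y < d2\<rbrakk> \<Longrightarrow> - f z - - f y \<le> - (s - e) * (z - y)"
    using not_steepD[OF below[of "s - e"]] \<open>0 < e\<close> by auto
  define d where "d = min d1 d2"
  have "0 < d" using d1 d2 by (simp add: d_def)
  have straddle: "\<bar>f z - f y - s * (z - y)\<bar> \<le> e * (z - y)" if "y < x" "x < z" "z - y < d" for y z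
    using d1(2)[of y z] d2(2)[of y z] that by (simp add: d_def algebra_simps abs_le_iff)
  have right: "\<bar>f z - f x - s * (z - x)\<bar> \<le> e * (z - x)" if z: "x < z" "z - x < d" for z
  proof (rule tendsto_le[OF trivial_limit_at_left_real])
    show "((\<lambda>y. \<bar>f z - f y - s * (z - y)\<bar>) \<longlongrightarrow> \<bar>f z - f x - s * (z - x)\<bar>) (at_left x)"
      using cont by (intro tendsto_intros) (simp add: isCont_def filterlim_at_split)
    show "((\<lambda>y. e * (z - y)) \<longlongrightarrow> e * (z - x)) (at_left x)"
      by (intro tendsto_intros)
    show "\<forall>\<^sub>F y in at_left x. \<bar>f z - f y - s * (z - y)\<bar> \<le> e * (z - y)"
      unfolding eventually_at_left_field
      using z by (intro exI[of _ "z - d"]) (auto intro!: straddle)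
  qed
  have left: "\<bar>f x - f y - s * (x - y)\<bar> \<le> e * (x - y)" if y: "y < x" "x - y < d" for y
  proof (rule tendsto_le[OF trivial_limit_at_right_real])
    show "((\<lambda>z. \<bar>f z - f y - s * (z - y)\<bar>) \<longlongrightarrow> \<bar>f x - f y - s * (x - y)\<bar>) (at_right x)"
      using cont by (intro tendsto_intros) (simp add: isCont_def filterlim_at_split)
    show "((\<lambda>z. e * (z - y)) \<longlongrightarrow> e * (x - y)) (at_right x)"
      by (intro tendsto_intros)
    show "\<forall>\<^sub>F z in at_right x. \<bar>f z - f y - s * (z - y)\<bar> \<le> e * (z - y)"
      unfolding eventually_at_right_field
      using y by (intro exI[of _ "y + d"]) (auto intro!: straddle)
  qed
  have "norm (f y - f x - s * (y - x)) \<le> e * norm (y - x)" if "norm (y - x) < d" for y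
    using right[of y] left[of y] that by (cases y x rule: linorder_cases) (auto simp: algebra_simps abs_le_iff)
  then show "\<exists>d>0. \<forall>y. norm (y - x) < d \<longrightarrow> norm (f y - f x - s * (y - x)) \<le> e * norm (y - x)"
    using \<open>0 < d\<close> by blast
qed (rule bounded_linear_mult_right)

lemma steep_mono: "p \<le> q \<Longrightarrow> steep f q \<subseteq> steep f p"
proof
  fix x assume "p \<le> q" and x: "x \<in> steep f q"
  show "x \<in> steep f p"
    unfolding steep_def
  proof (intro CollectI allI impI)
    fix d :: real assume "0 < d"
    then obtain y z where yz: "y < x" "x < z" "z - y < d" "q * (z - y) < f z - f y"
      using x unfolding steep_def by blast
    moreover have "p * (z - y) \<le> q * (z - y)"
      using \<open>p \<le> q\<close> yz by (intro mult_right_mono) auto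
    ultimately show "\<exists>y z. y < x \<and> x < z \<and> z - y < d \<and> p * (z - y) < f z - f y"
      by (meson le_less_trans)
  qed
qed

text \<open>The derivative arises as a cut: it is the supremum of the numbers that bound all short
  enough slopes around \<open>x\<close> from below. \<open>fin\<close> makes this supremum finite
  and \<open>sep\<close> makes it an upper bound in the limit. Only rational pairs enter
  \<open>sep\<close>, so the exceptional sets will be countable in number.\<close>

lemma exists_derivative_if_not_steep:
  fixes f :: "real \<Rightarrow> real"
  assumes cont: "isCont f x"
    and fin: "x \<notin> steep f (real m)" "x \<notin> steep (\<lambda>x. - f x) (real n)"
    and sep: "\<And>p q. \<lbrakk>p \<in> \<rat>; q \<in> \<rat>; p < q\<rbrakk> \<Longrightarrow> x \<notin> steep f q \<or> x \<notin> steep (\<lambda>x. - f x) (- p)"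
  shows "\<exists>s. (f has_real_derivative s) (at x)"
proof -
  define P where "P = {p. x \<notin> steep (\<lambda>x. - f x) (- p)}"
  have P_le: "p \<le> q" if p: "p \<in> P" and q: "x \<notin> steep f q" for p q
  proof -
    obtain d where d: "0 < d" "\<And>y z. \<lbrakk>y < x; x < z; z - y < d\<rbrakk> \<Longrightarrow> f z - f y \<le> q * (z - y)"
      using not_steepD[OF q] by blast
    obtain d' where d': "0 < d'" "\<And>y z. \<lbrakk>y < x; x < z; z - y < d'\<rbrakk> \<Longrightarrow> - f z - - f y \<le> - p * (z - y)"
      using not_steepD[of x "\<lambda>x. - f x" "- p"] p unfolding P_def by blast
    \<comment> \<open>The symmetric interval of width \<open>2 * h\<close> is short enough for both
      bounds, so its slope lies between \<open>p\<close> and \<open>q\<close>.\<close>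
    define h where "h = min d d' / 3"
    have h: "0 < h" "2 * h < d" "2 * h < d'"
      using d(1) d'(1) by (auto simp: h_def)
    then have "f (x + h) - f (x - h) \<le> q * (2 * h)" "p * (2 * h) \<le> f (x + h) - f (x - h)"
      using d(2)[of "x - h" "x + h"] d'(2)[of "x - h" "x + h"] by auto
    then have "p * (2 * h) \<le> q * (2 * h)"
      by linarith
    then show ?thesis
      using h by simp
  qed
  have P: "- real n \<in> P" "bdd_above P"
    using fin P_le by (auto simp: P_def intro!: bdd_aboveI[of _ "real m"])
  define s where "s = Sup P"
  have "(f has_real_derivative s) (at x)"
  proof (rule has_real_derivative_if_not_steep[OF cont])
    fix q assume "s < q"
    \<comment> \<open>Two rationals are placed between \<open>s\<close> and \<open>q\<close>. The
      lower one exceeds the supremum, so it is not in \<open>P\<close>, and \<open>sep\<close> then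
      excludes steepness at the upper one.\<close>
    then obtain p' where p': "p' \<in> \<rat>" "s < p'" "p' < q"
      using Rats_dense_in_real by blast
    then obtain q' where q': "q' \<in> \<rat>" "p' < q'" "q' < q"
      using Rats_dense_in_real by blast
    have "p' \<notin> P"
      using cSup_upper[OF _ P(2), of p'] p'(2) by (auto simp: s_def)
    then have "x \<notin> steep f q'"
      using sep[OF p'(1) q'(1,2)] by (auto simp: P_def)
    then show "x \<notin> steep f q"
      using steep_mono[of q' q f] q'(3) by auto
  next
    fix p assume "p < s"
    then obtain p' where "p' \<in> P" "p < p'"
      using less_cSup_iff[of P p] P by (auto simp: s_def)
    then show "x \<notin> steep (\<lambda>x. - f x) (- p)"
      using steep_mono[of "- p'" "- p" "\<lambda>x. - f x"] by (auto simp: P_def)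
  qed
  then show ?thesis ..
qed

text \<open>At a point without derivative some hypothesis of
  \<open>exists_derivative_if_not_steep\<close> fails: \<open>f\<close> or \<open>- f\<close> is
  infinitely steep, or a rational pair separates lower from upper slopes. These are countably many
  null sets.\<close>

lemma absolutely_continuous_real_differentiable_AE:
  fixes f :: "real \<Rightarrow> real"
  assumes f: "absolutely_continuous_on_interval a b f"
  shows "negligible {x \<in> {a<..<b}. \<not> (\<exists>s. (f has_real_derivative s) (at x))}"
proof -
  define E where "E p q = {a<..<b} \<inter> steep f q \<inter> steep (\<lambda>x. - f x) (- p)" for p q
  define I where "I g = {a<..<b} \<inter> (\<Inter>n::nat. steep g n)" for g
  have "negligible (I f)" "negligible (I (\<lambda>x. - f x))"
    unfolding I_def
    by (intro negligible_infinitely_steep f absolutely_continuous_on_interval_minus)+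
  moreover have "negligible (\<Union>(p, q) \<in> {(p, q) \<in> \<rat> \<times> \<rat>. p < q}. E p q)"
  proof (rule negligible_countable_Union)
    have "countable {(p, q) \<in> \<rat> \<times> \<rat>. p < (q::real)}"
      by (rule countable_subset[of _ "\<rat> \<times> \<rat>"]) (auto intro: countable_rat)
    then show "countable ((\<lambda>(p, q). E p q) ` {(p, q) \<in> \<rat> \<times> \<rat>. p < q})"
      by (rule countable_image)
    show "negligible S" if "S \<in> (\<lambda>(p, q). E p q) ` {(p, q) \<in> \<rat> \<times> \<rat>. p < q}" for S
      using that negligible_upper_lower_steep[OF f] by (auto simp: E_def)
  qed
  ultimately have "negligible (I f \<union> I (\<lambda>x. - f x) \<union> (\<Union>(p, q) \<in> {(p, q) \<in> \<rat> \<times> \<rat>. p < q}. E p q))"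
    by (intro negligible_Un)
  then show ?thesis
  proof (rule negligible_subset, intro subsetI)
    fix x assume x: "x \<in> {x \<in> {a<..<b}. \<not> (\<exists>s. (f has_real_derivative s) (at x))}"
    have "isCont f x"
      using absolutely_continuous_imp_continuous_on[OF f] x
      by (intro continuous_on_interior[of "{a..b}"]) auto
    from exists_derivative_if_not_steep[OF this]
    show "x \<in> I f \<union> I (\<lambda>x. - f x) \<union> (\<Union>(p, q) \<in> {(p, q) \<in> \<rat> \<times> \<rat>. p < q}. E p q)"
      using x unfolding I_def E_def by fast
  qed
qed

lemma absolutely_continuous_differentiable_AE:
  fixes f :: "real \<Rightarrow> 'a::euclidean_space"
  assumes f: "absolutely_continuous_on_interval a b f"
  shows "negligible {x \<in> {a<..<b}. \<not> f differentiable (at x)}"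
proof -
  let ?N = "\<lambda>c. {x \<in> {a<..<b}. \<not> (\<exists>s. ((\<lambda>x. f x \<bullet> c) has_real_derivative s) (at x))}"
  have "negligible (?N c)" if "c \<in> Basis" for c
    by (intro absolutely_continuous_real_differentiable_AE absolutely_continuous_on_interval_inner[OF f] that)
  then have "negligible (\<Union>c\<in>Basis. ?N c)"
    by (intro negligible_Union) auto
  then show ?thesis
  proof (rule negligible_subset, intro subsetI)
    fix x assume x: "x \<in> {x \<in> {a<..<b}. \<not> f differentiable (at x)}"
    then obtain c where "c \<in> Basis" "\<not> (\<lambda>x. f x \<bullet> c) differentiable (at x)"
      using differentiable_componentwise_within[of f x UNIV] by auto
    then show "x \<in> (\<Union>c\<in>Basis. ?N c)"
      using x by (auto simp: differentiable_def has_field_derivative_def)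
  qed
qed

section \<open>The fundamental theorem of calculus\<close>

text \<open>Dropping the tags can merge two pairs only if they share their interval, which is then a
  single point with zero increment.\<close>

lemma sum_increments_tagged_partial:
  fixes f :: "real \<Rightarrow> 'a::real_normed_vector"
  assumes p: "p tagged_partial_division_of S"
  shows "(\<Sum>(x, K)\<in>p. norm (f (Sup K) - f (Inf K))) = (\<Sum>K\<in>snd ` p. norm (f (Sup K) - f (Inf K)))"
proof -
  have degenerate: "norm (f (Sup (snd i)) - f (Inf (snd i))) = 0"
    if ij: "i \<in> p" "j \<in> p" "i \<noteq> j" "snd i = snd j" for i j
  proof -
    obtain x y K where xy: "i = (x, K)" "j = (y, K)"
      using ij(4) by (metis prod.collapse)
    then have "interior K = {}"
      using tagged_partial_division_ofD(5)[OF p, of x K y K] ij by auto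
    moreover obtain y z where "K = cbox y z" "K \<noteq> {}"
      using tagged_partial_division_ofD(2,4)[OF p, of x K] ij xy by blast
    ultimately show ?thesis
      using xy by auto
  qed
  have "(\<Sum>K\<in>snd ` p. norm (f (Sup K) - f (Inf K))) = sum ((\<lambda>K. norm (f (Sup K) - f (Inf K))) \<circ> snd) p"
    by (rule sum.reindex_nontrivial[OF tagged_partial_division_ofD(1)[OF p]]) (rule degenerate)
  then show ?thesis
    by (simp add: case_prod_unfold comp_def)
qed

text \<open>The gauge integral gives integrability and value together. Intervals tagged outside
  \<open>N\<close> are controlled by the derivative, those tagged in \<open>N\<close> by absolute
  continuity.\<close>

lemma fundamental_theorem_of_calculus_absolutely_continuous:
  fixes f :: "real \<Rightarrow> 'a::euclidean_space"
  assumes ab: "a \<le> b" and f: "absolutely_continuous_on_interval a b f" and N: "negligible N"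
    and deriv: "\<And>x. x \<in> {a..b} - N \<Longrightarrow> (f has_vector_derivative f' x) (at x within {a..b})"
  shows "(f' has_integral (f b - f a)) {a..b}"
proof -
  \<comment> \<open>With value 0 on \<open>N\<close>, the error of a tag in \<open>N\<close> is just
    an increment; the null set is repaired at the end.\<close>
  define g where "g x = (if x \<in> N then 0 else f' x)" for x
  have "(g has_integral (f b - f a)) {a..b}"
    unfolding has_integral_real
  proof (intro allI impI)
    fix e :: real assume "0 < e"
    then have "0 < e / 2" by simp
    then obtain \<delta> where "0 < \<delta>" and \<delta>: "\<And>d S. \<lbrakk>d division_of S; S \<subseteq> {a..b}; (\<Sum>K\<in>d. Sup K - Inf K) < \<delta>\<rbrakk>
       \<Longrightarrow> (\<Sum>K\<in>d. norm (f (Sup K) - f (Inf K))) < e / 2"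
      using absolutely_continuous_on_intervalE[OF f] by blast
    obtain V where V: "open V" "N \<subseteq> V" "V - N \<in> lmeasurable" "emeasure lebesgue (V - N) < ennreal \<delta>"
      using sets_lebesgue_outer_open[OF negligible_imp_sets[OF N] \<open>0 < \<delta>\<close>] by blast
    have VN: "V = (V - N) \<union> N"
      using V(2) by blast
    have Vm: "V \<in> lmeasurable"
      by (subst VN) (intro fmeasurable.Un V(3) negligible_imp_measurable[OF N])
    have mV: "measure lebesgue V < \<delta>"
    proof -
      have "measure lebesgue V \<le> measure lebesgue (V - N) + measure lebesgue N"
        using V(3) negligible_imp_sets[OF N] by (subst VN, intro measure_Un_le) auto
      also have "\<dots> < \<delta>"
        using V(3,4) \<open>0 < \<delta>\<close> negligible_imp_measure0[OF N]
        by (simp add: emeasure_eq_measure2 ennreal_less_iff)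
      finally show ?thesis .
    qed
    \<comment> \<open>The summand 1 gives a strict bound and covers \<open>a = b\<close>.\<close>
    define \<epsilon> where "\<epsilon> = e / (2 * (b - a + 1))"
    have \<epsilon>: "0 < \<epsilon>" "\<epsilon> * (b - a) < e / 2"
      using \<open>0 < e\<close> ab by (auto simp: \<epsilon>_def field_simps)
    \<comment> \<open>The gauge radius keeps intervals tagged in \<open>N\<close> inside
      \<open>V\<close>, and elsewhere makes the linear approximation
      \<open>\<epsilon>\<close>-accurate.\<close>
    have "\<exists>d>0. if x \<in> N then ball x d \<subseteq> V else x \<in> {a..b} \<longrightarrow>
        (\<forall>y\<in>{a..b}. norm (y - x) < d \<longrightarrow> norm (f y - f x - (y - x) *\<^sub>R f' x) \<le> \<epsilon> * norm (y - x))" for x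
    proof (cases "x \<in> N")
      case True
      then show ?thesis
        using V(1,2) by (auto simp: open_contains_ball)
    next
      case False
      show ?thesis
      proof (cases "x \<in> {a..b}")
        case True
        then show ?thesis
          using deriv[of x] False \<epsilon>(1) unfolding has_vector_derivative_def has_derivative_within_alt by auto
      qed (use False in \<open>auto intro: exI[of _ 1]\<close>)
    qed
    then obtain d where d: "\<And>x. 0 < d x" "\<And>x. x \<in> N \<Longrightarrow> ball x (d x) \<subseteq> V"
      "\<And>x y. \<lbrakk>x \<notin> N; x \<in> {a..b}; y \<in> {a..b}; norm (y - x) < d x\<rbrakk>
         \<Longrightarrow> norm (f y - f x - (y - x) *\<^sub>R f' x) \<le> \<epsilon> * norm (y - x)"
      by metis
    show "\<exists>\<gamma>. gauge \<gamma> \<and> (\<forall>\<D>. \<D> tagged_division_of {a..b} \<and> \<gamma> fine \<D> \<longrightarrow>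
        norm ((\<Sum>(x, K)\<in>\<D>. measure lborel K *\<^sub>R g x) - (f b - f a)) < e)"
    proof (intro exI[of _ "\<lambda>x. ball x (d x)"] conjI allI impI)
      show "gauge (\<lambda>x. ball x (d x))"
        using d(1) gauge_ball_dependent by blast
      fix p assume "p tagged_division_of {a..b} \<and> (\<lambda>x. ball x (d x)) fine p"
      then have p: "p tagged_division_of {a..b}" and fine: "(\<lambda>x. ball x (d x)) fine p"
        by auto
      note finp = tagged_division_of_finite[OF p]
      let ?inc = "\<lambda>K. f (Sup K) - f (Inf K)"
      let ?err = "\<lambda>(x, K). measure lborel K *\<^sub>R g x - ?inc K"
      define B where "B = {i \<in> p. fst i \<in> N}"
      have Bp: "B \<subseteq> p" by (auto simp: B_def)
      have B: "B tagged_partial_division_of {a..b}"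
        using tagged_partial_division_subset Bp p by (metis tagged_division_of_def)
      have bad: "norm (sum ?err B) < e / 2"
      proof -
        note div = partial_division_of_tagged_division[OF B]
        have "\<Union>(snd ` B) \<subseteq> V"
          using d(2) fine Bp by (force simp: B_def fine_def)
        then have "measure lebesgue (\<Union>(snd ` B)) \<le> measure lebesgue V"
          using division_lmeasurable[OF div] Vm by (intro measure_mono_fmeasurable) auto
        moreover have "\<Union>(snd ` B) \<subseteq> {a..b}"
          using tagged_partial_division_ofD(3)[OF B] by force
        ultimately have "(\<Sum>K\<in>snd ` B. norm (?inc K)) < e / 2"
          using mV by (intro \<delta>[OF div]) (auto simp: sum_length_division_eq_measure[OF div])
        moreover have "norm (sum ?err B) \<le> (\<Sum>(x, K)\<in>B. norm (?inc K))"
          by (intro sum_norm_le) (auto simp: B_def g_def norm_minus_commute)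
        ultimately show ?thesis
          by (simp add: sum_increments_tagged_partial[OF B])
      qed
      have good: "norm (sum ?err (p - B)) \<le> \<epsilon> * (b - a)"
      proof -
        have "norm (?err i) \<le> \<epsilon> * (Sup (snd i) - Inf (snd i))" if i: "i \<in> p - B" for i
        proof -
          obtain x K where xK: "i = (x, K)" by (cases i)
          then have K: "(x, K) \<in> p" "x \<notin> N"
            using i by (auto simp: B_def)
          then obtain y z where yz: "K = {y..z}" "x \<in> K" "K \<subseteq> {a..b}"
            using tagged_division_ofD(2,3,4)[OF p K(1)] by (metis box_real(2))
          have "K \<subseteq> ball x (d x)"
            using fine K by auto
          then have mem: "y \<in> ball x (d x)" "z \<in> ball x (d x)" "x \<in> {a..b}" "y \<in> {a..b}" "z \<in> {a..b}"
            using yz(2,3) unfolding yz(1) by (auto simp del: mem_ball)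
          then have "norm (f y - f x - (y - x) *\<^sub>R f' x) \<le> \<epsilon> * norm (y - x)"
              "norm (f z - f x - (z - x) *\<^sub>R f' x) \<le> \<epsilon> * norm (z - x)"
            using d(3)[OF K(2) mem(3,4)] d(3)[OF K(2) mem(3,5)]
            by (simp_all add: dist_real_def abs_minus_commute)
          \<comment> \<open>The approximations at both endpoints are subtracted. As the tag lies
            between \<open>y\<close> and \<open>z\<close>, the two errors add up to at most
            \<open>\<epsilon> * (z - y)\<close>.\<close>
          moreover have "norm ((z - y) *\<^sub>R f' x - (f z - f y))
              \<le> norm (f y - f x - (y - x) *\<^sub>R f' x) + norm (f z - f x - (z - x) *\<^sub>R f' x)"
            using norm_triangle_ineq4[of "f y - f x - (y - x) *\<^sub>R f' x" "f z - f x - (z - x) *\<^sub>R f' x"]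
            by (simp add: algebra_simps)
          ultimately show ?thesis
            using yz K(2) by (simp add: xK g_def algebra_simps)
        qed
        then have "norm (sum ?err (p - B)) \<le> (\<Sum>i\<in>p - B. \<epsilon> * (Sup (snd i) - Inf (snd i)))"
          by (intro sum_norm_le) auto
        also have "\<dots> \<le> (\<Sum>i\<in>p. \<epsilon> * (Sup (snd i) - Inf (snd i)))"
        proof (rule sum_mono2[OF finp])
          fix i assume "i \<in> p - (p - B)"
          then obtain x K where "i = (x, K)" "(x, K) \<in> p"
            by (cases i) auto
          moreover then obtain y z where "K = cbox y z" "x \<in> K"
            using tagged_division_ofD(2,4)[OF p] by blast
          ultimately show "0 \<le> \<epsilon> * (Sup (snd i) - Inf (snd i))"
            using \<epsilon>(1) by auto
        qed auto
        also have "\<dots> = \<epsilon> * (b - a)"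
          using additive_tagged_division_1[OF ab p, of "\<lambda>x. x"]
          by (simp add: sum_distrib_left[symmetric] case_prod_unfold)
        finally show ?thesis .
      qed
      have "(\<Sum>(x, K)\<in>p. measure lborel K *\<^sub>R g x) - (f b - f a) = sum ?err p"
        using additive_tagged_division_1[OF ab p, of f] by (simp add: case_prod_unfold sum_subtractf)
      also have "\<dots> = sum ?err (p - B) + sum ?err B"
        by (rule sum.subset_diff[OF Bp finp])
      finally have split: "(\<Sum>(x, K)\<in>p. measure lborel K *\<^sub>R g x) - (f b - f a)
          = sum ?err (p - B) + sum ?err B" .
      have "norm ((\<Sum>(x, K)\<in>p. measure lborel K *\<^sub>R g x) - (f b - f a))
          \<le> norm (sum ?err (p - B)) + norm (sum ?err B)"
        unfolding split by (rule norm_triangle_ineq)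
      then show "norm ((\<Sum>(x, K)\<in>p. measure lborel K *\<^sub>R g x) - (f b - f a)) < e"
        using bad good \<epsilon>(2) by linarith
    qed
  qed
  then show ?thesis
    by (rule has_integral_spike[OF N, rotated]) (simp add: g_def)
qed

section \<open>The Orlicz estimate\<close>

lemma absolutely_continuous_on_interval_subset:
  assumes "absolutely_continuous_on_interval a b f" "{c..d} \<subseteq> {a..b}"
  shows "absolutely_continuous_on_interval c d f"
  unfolding absolutely_continuous_on_interval_def
proof (intro allI impI)
  fix \<epsilon> :: real assume "0 < \<epsilon>"
  then obtain \<delta> where "0 < \<delta>"
    "\<And>d S. \<lbrakk>d division_of S; S \<subseteq> {a..b}; (\<Sum>K\<in>d. Sup K - Inf K) < \<delta>\<rbrakk>
       \<Longrightarrow> (\<Sum>K\<in>d. norm (f (Sup K) - f (Inf K))) < \<epsilon>"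
    using absolutely_continuous_on_intervalE[OF assms(1)] by blast
  then show "\<exists>\<delta>>0. \<forall>p S. p division_of S \<and> S \<subseteq> {c..d} \<and> (\<Sum>K\<in>p. Sup K - Inf K) < \<delta> \<longrightarrow>
      (\<Sum>K\<in>p. norm (f (Sup K) - f (Inf K))) < \<epsilon>"
    using assms(2) by (meson subset_trans)
qed

text \<open>Jensen's inequality in several dimensions. If it failed, the mean of
  \<open>(X, G X)\<close> would lie outside the closed convex epigraph, and a strictly separating
  hyperplane would contradict the integrated pointwise inequality.\<close>

lemma convex_on_average_le:
  fixes X :: "'a \<Rightarrow> 'b::euclidean_space"
  assumes "finite_measure M" and pos: "0 < measure M (space M)" and G: "convex_on UNIV G"
    and X: "integrable M X" and GX: "integrable M (\<lambda>x. G (X x))"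
  shows "G ((LINT x|M. X x) /\<^sub>R measure M (space M)) \<le> (LINT x|M. G (X x)) / measure M (space M)"
proof (rule ccontr)
  interpret finite_measure M by fact
  define \<mu> where "\<mu> = measure M (space M)"
  let ?z = "((LINT x|M. X x) /\<^sub>R \<mu>, (LINT x|M. G (X x)) / \<mu>)"
  assume "\<not> ?thesis"
  then have outside: "?z \<notin> epigraph UNIV G"
    by (simp add: epigraph_def \<mu>_def)
  have convex_epi: "convex (epigraph UNIV G)"
    using G by (simp add: convex_epigraph)
  have closed_epi: "closed (epigraph UNIV G)"
  proof -
    have "continuous_on UNIV (\<lambda>z::'b \<times> real. G (fst z))"
      by (rule continuous_on_compose2[OF convex_on_continuous[OF open_UNIV G]])
         (simp_all add: continuous_on_fst continuous_on_id)
    then have "closed {z::'b \<times> real. G (fst z) \<le> snd z}"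
      by (intro closed_Collect_le continuous_on_snd continuous_on_id)
    then show ?thesis
      by (simp add: epigraph_def)
  qed
  obtain a b where ab: "inner a ?z < b" "\<forall>w\<in>epigraph UNIV G. inner a w > b"
    using separating_hyperplane_closed_point[OF convex_epi closed_epi outside] by (elim exE conjE) (rule that)
  obtain a1 a2 where a: "a = (a1, a2)" by (cases a)
  have "b \<le> a1 \<bullet> X x + a2 * G (X x)" for x
    using bspec[OF ab(2), of "(X x, G (X x))"] by (simp add: a epigraph_def inner_prod_def)
  then have "(LINT x|M. b) \<le> (LINT x|M. a1 \<bullet> X x + a2 * G (X x))"
    using X GX by (intro integral_mono) auto
  also have "\<dots> = a1 \<bullet> (LINT x|M. X x) + a2 * (LINT x|M. G (X x))"
    using X GX by (subst Bochner_Integration.integral_add) auto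
  finally have "b \<le> a1 \<bullet> ((LINT x|M. X x) /\<^sub>R \<mu>) + a2 * ((LINT x|M. G (X x)) / \<mu>)"
    using pos by (simp add: \<mu>_def field_simps)
  then show False
    using ab(1) by (simp add: a inner_prod_def)
qed

section \<open>Growth and duality bounds for \<open>G\<close>\<close>

text \<open>Superlinear growth gives \<open>norm u \<le> G u\<close> outside a ball, whose radius
  absorbs the rest. This makes the derivative integrable once \<open>G (T u')\<close> is.\<close>

lemma G_function_norm_le:
  assumes "G_function G"
  obtains R where "0 \<le> R" "\<And>u. norm u \<le> R + G u"
proof -
  have "\<forall>\<^sub>F u in at_infinity. 1 \<le> G u / norm u"
    using assms by (auto simp: G_function_def filterlim_at_top)
  then obtain b where b: "\<And>u. b \<le> norm u \<Longrightarrow> 1 \<le> G u / norm u"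
    by (auto simp: eventually_at_infinity)
  have "norm u \<le> \<bar>b\<bar> + G u" for u
  proof (cases "b \<le> norm u")
    case True
    \<comment> \<open>Division by zero yields 0, which contradicts the quotient being at least
      1.\<close>
    have "norm u \<noteq> 0"
      using b[OF True] by auto
    then have "norm u \<le> G u"
      using b[OF True] by (simp add: field_simps)
    then show ?thesis by simp
  next
    case False
    moreover have "0 \<le> G u"
      using assms by (simp add: G_function_def)
    ultimately show ?thesis by simp
  qed
  then show thesis
    using that[of "\<bar>b\<bar>"] by simp
qed

lemma inner_le_convex_conjugate:
  "ereal (u \<bullet> v - G u) \<le> convex_conjugate G v"
  unfolding convex_conjugate_def by (rule SUP_upper) simp

lemma inner_sympl_J_left: "sympl_J x \<bullet> y = - (x \<bullet> sympl_J y)"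
  by (simp add: sympl_J_def inner_prod_def inner_commute)

lemma linear_sympl_J: "linear sympl_J"
  by (rule linearI) (auto simp: sympl_J_def)

text \<open>Fenchel's inequality is applied to \<open>v\<close> and \<open>J (w / K)\<close>, so
  that the hypothesis returns \<open>G w\<close> itself. Linearity restores the factor
  \<open>K\<close>, and antisymmetry of \<open>J\<close> the sign.\<close>

lemma semi_symplectic_young:
  assumes G: "semi_symplectic G"
  obtains K C where "0 < K" "0 \<le> C" "\<And>v w. sympl_J v \<bullet> w \<ge> - K * (G v + G w + C)"
proof -
  obtain K C where K: "0 < K" "0 \<le> C" "\<And>u. convex_conjugate G (sympl_J u) \<le> ereal (G (K *\<^sub>R u) + C)"
    using G unfolding semi_symplectic_def by blast
  have "sympl_J v \<bullet> w \<ge> - K * (G v + G w + C)" for v w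
  proof -
    have "K *\<^sub>R (w /\<^sub>R K) = w"
      using K(1) by simp
    then have "ereal (v \<bullet> sympl_J (w /\<^sub>R K) - G v) \<le> ereal (G w + C)"
      using order_trans[OF inner_le_convex_conjugate K(3)[of "w /\<^sub>R K"]] by simp
    then have "v \<bullet> sympl_J (w /\<^sub>R K) \<le> G v + G w + C"
      by simp
    moreover have "v \<bullet> sympl_J w = K * (v \<bullet> sympl_J (w /\<^sub>R K))"
      using K(1) by (simp add: linear_scale[OF linear_sympl_J])
    ultimately have "v \<bullet> sympl_J w \<le> K * (G v + G w + C)"
      using K(1) by simp
    then show ?thesis
      by (simp add: inner_sympl_J_left)
  qed
  then show thesis
    using that K by blast
qed

section \<open>Increments of \<open>u\<close> and the final estimate\<close>

lemma has_integral_time_deriv: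
  fixes u :: "real \<Rightarrow> 'a::euclidean_space"
  assumes u: "absolutely_continuous_on_interval 0 T u" and t: "t \<in> {0..T}"
  shows "(time_deriv T u has_integral (u t - u 0)) {0..t}"
proof (rule fundamental_theorem_of_calculus_absolutely_continuous)
  show "absolutely_continuous_on_interval 0 t u"
    by (rule absolutely_continuous_on_interval_subset[OF u]) (use t in auto)
  \<comment> \<open>Two-sided differentiability is known only in the open interval, so both
    endpoints join the null set.\<close>
  let ?N = "{x \<in> {0<..<T}. \<not> u differentiable (at x)} \<union> {0, T}"
  show "negligible ?N"
    by (intro negligible_Un absolutely_continuous_differentiable_AE[OF u]) auto
  fix x assume x: "x \<in> {0..t} - ?N"
  then have "u differentiable (at x within {0..T})"
    using t by (auto intro: differentiable_at_withinI)
  then have "(u has_vector_derivative time_deriv T u x) (at x within {0..T})"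
    by (simp add: time_deriv_def vector_derivative_works)
  then show "(u has_vector_derivative time_deriv T u x) (at x within {0..t})"
    by (rule has_vector_derivative_within_subset) (use t in auto)
qed (use t in auto)

lemma G_increment_le_average:
  fixes u :: "real \<Rightarrow> 'a::euclidean_space"
  assumes T: "0 < T" and u: "absolutely_continuous_on_interval 0 T u" and G: "G_function G"
    and v: "integrable (lebesgue_on {0..T}) (time_deriv T u)"
    and Gv: "integrable (lebesgue_on {0..T}) (\<lambda>s. G (T *\<^sub>R time_deriv T u s))"
    and t: "t \<in> {0..T}"
  shows "G (u t - u 0) \<le> (LINT s|lebesgue_on {0..T}. G (T *\<^sub>R time_deriv T u s)) / T"
proof -
  let ?M = "lebesgue_on {0..T}"
  \<comment> \<open>The factor \<open>T\<close> offsets the division by \<open>T\<close> in the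
    average, so \<open>X\<close> has mean \<open>u t - u 0\<close>. Since \<open>G 0 = 0\<close>,
    \<open>G\<close> commutes with the cut-off.\<close>
  define X where "X s = indicator {0..t} s *\<^sub>R T *\<^sub>R time_deriv T u s" for s
  have G_facts: "convex_on UNIV G" "G 0 = 0" "\<And>x. 0 \<le> G x"
    using G by (auto simp: G_function_def)
  have t': "{0..t} \<inter> {0..T} \<in> sets lebesgue" "{0..t} \<subseteq> {0..T}"
    using t by auto
  have ind: "{0..t} \<in> sets ?M"
    using t by (auto simp: sets_restrict_space_iff)
  have X: "integrable ?M X"
    unfolding X_def by (intro integrable_mult_indicator ind integrable_scaleR_right v)
  have GX_eq: "G (X s) = indicator {0..t} s *\<^sub>R G (T *\<^sub>R time_deriv T u s)" for s
    by (simp add: X_def G_facts(2) indicator_def)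
  have GX: "integrable ?M (\<lambda>s. G (X s))"
    unfolding GX_eq by (intro integrable_mult_indicator ind Gv)
  have space: "measure ?M (space ?M) = T"
    using T by (simp add: measure_restrict_space)
  have fin: "finite_measure ?M"
    by (rule finite_measure_lebesgue_on) simp
  have "(LINT s|?M. X s) = T *\<^sub>R (u t - u 0)"
  proof (rule has_integral_unique)
    show "(X has_integral (LINT s|?M. X s)) {0..T}"
      by (rule has_integral_integral_lebesgue_on[OF X]) simp
    have "((\<lambda>s. T *\<^sub>R time_deriv T u s) has_integral T *\<^sub>R (u t - u 0)) {0..t}"
      by (intro has_integral_cmul has_integral_time_deriv[OF u t])
    then have "((\<lambda>s. if s \<in> {0..t} then T *\<^sub>R time_deriv T u s else 0) has_integral T *\<^sub>R (u t - u 0)) {0..T}"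
      by (simp only: has_integral_restrict[OF t'(2)])
    then show "(X has_integral T *\<^sub>R (u t - u 0)) {0..T}"
      by (rule has_integral_eq[rotated]) (simp add: X_def indicator_def)
  qed
  then have "(LINT s|?M. X s) /\<^sub>R T = u t - u 0"
    using T by simp
  then have "G (u t - u 0) \<le> (LINT s|?M. G (X s)) / T"
    using convex_on_average_le[OF fin _ G_facts(1) X GX] T unfolding space by simp
  also have "(LINT s|?M. G (X s)) \<le> (LINT s|?M. G (T *\<^sub>R time_deriv T u s))"
    by (rule integral_mono[OF GX Gv]) (auto simp: GX_eq indicator_def G_facts(3))
  finally show ?thesis
    using T by (simp add: divide_right_mono)
qed

theorem theorem3p5:
  fixes G :: "(real ^ 'n) \<times> (real ^ 'n) \<Rightarrow> real" and T :: real
  assumes "0 < T"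
    and "G_function G"
    and "semi_symplectic G"
  shows "\<exists>C1>0. \<exists>C2>0. \<forall>u \<in> periodic_Orlicz_Sobolev G T.
           ereal (LINT t|lebesgue_on {0..T}. sympl_J (time_deriv T u t) \<bullet> u t)
             \<ge> - (ereal C1 * enn2ereal (\<integral>\<^sup>+ t. ennreal (G (T *\<^sub>R time_deriv T u t)) \<partial>lebesgue_on {0..T}))
                - ereal C2"
proof -
  let ?M = "lebesgue_on {0..T}"
  obtain K C where KC: "0 < K" "0 \<le> C" "\<And>v w. sympl_J v \<bullet> w \<ge> - K * (G v + G w + C)"
    using semi_symplectic_young[OF assms(3)] by blast
  obtain R where R: "0 \<le> R" "\<And>x. norm x \<le> R + G x"
    using G_function_norm_le[OF assms(2)] by blast
  have G_facts: "convex_on UNIV G" "\<And>x. 0 \<le> G x"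
    using assms(2) by (auto simp: G_function_def)
  have G_cont: "continuous_on UNIV G"
    by (rule convex_on_continuous[OF open_UNIV G_facts(1)])
  have G_meas: "G \<in> borel_measurable borel"
    by (rule borel_measurable_continuous_onI[OF G_cont])
  have J_meas: "sympl_J \<in> borel_measurable (borel :: ((real ^ 'n) \<times> (real ^ 'n)) measure)"
    by (intro borel_measurable_continuous_onI linear_continuous_on linear_conv_bounded_linear[THEN iffD1] linear_sympl_J)
  have J_norm: "norm (sympl_J x) = norm x" for x :: "(real ^ 'n) \<times> (real ^ 'n)"
    by (cases x) (simp add: sympl_J_def norm_Pair add.commute)
  interpret finite_measure ?M
    by (rule finite_measure_lebesgue_on) simp
  have space: "measure ?M (space ?M) = T"
    using assms(1) by (simp add: measure_restrict_space)
  \<comment> \<open>The case where the integral on the right is finite, stated with Lebesgue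
    integrals.\<close>
  have main: "- (2 * K / T) * (LINT t|?M. G (T *\<^sub>R time_deriv T u t)) - K * C
        \<le> (LINT t|?M. sympl_J (time_deriv T u t) \<bullet> u t)"
    if u: "u \<in> periodic_Orlicz_Sobolev G T"
      and Gv: "integrable ?M (\<lambda>t. G (T *\<^sub>R time_deriv T u t))" for u
  proof -
    define v where "v = time_deriv T u"
    define w where "w t = u t - u 0" for t
    define I where "I = (LINT t|?M. G (T *\<^sub>R v t))"
    have ac: "absolutely_continuous_on_interval 0 T u" and per: "u T = u 0"
      and v_meas: "v \<in> borel_measurable ?M"
      using u by (auto simp: periodic_Orlicz_Sobolev_def Orlicz_space_def v_def)
    have v: "integrable ?M v"
    proof (rule Bochner_Integration.integrable_bound)
      show "integrable ?M (\<lambda>t. (R + G (T *\<^sub>R v t)) / T)"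
        using Gv by (auto simp: v_def)
      have "norm (v t) \<le> (R + G (T *\<^sub>R v t)) / T" for t
        using R(2)[of "T *\<^sub>R v t"] assms(1) by (simp add: field_simps)
      then show "AE t in ?M. norm (v t) \<le> norm ((R + G (T *\<^sub>R v t)) / T)"
        by (intro AE_I2) (metis abs_ge_self order_trans real_norm_def)
    qed (rule v_meas)
    have w_le: "G (w t) \<le> I / T" if "t \<in> {0..T}" for t
      using G_increment_le_average[OF assms(1) ac assms(2) _ Gv that] v by (simp add: v_def w_def I_def)
    have w_cont: "continuous_on {0..T} w"
      unfolding w_def by (intro continuous_intros absolutely_continuous_imp_continuous_on[OF ac])
    have w_meas: "w \<in> borel_measurable ?M"
      by (rule continuous_imp_measurable_on_sets_lebesgue[OF w_cont]) simp
    obtain B where B: "\<And>t. t \<in> {0..T} \<Longrightarrow> norm (w t) \<le> B"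
      using compact_imp_bounded[OF compact_continuous_image[OF w_cont compact_Icc]]
      unfolding bounded_iff by blast
    have Gw: "integrable ?M (\<lambda>t. G (w t))"
    proof (rule integrable_const_bound)
      show "AE t in ?M. norm (G (w t)) \<le> I / T"
        using w_le G_facts(2) by (intro AE_I2) simp
    qed (rule measurable_compose[OF w_meas G_meas])
    have Jv: "integrable ?M (\<lambda>t. sympl_J (v t))"
      by (rule Bochner_Integration.integrable_bound[OF v])
         (use measurable_compose[OF v_meas J_meas] in \<open>auto simp: J_norm\<close>)
    have Jvw: "integrable ?M (\<lambda>t. sympl_J (v t) \<bullet> w t)"
    proof (rule Bochner_Integration.integrable_bound)
      show "integrable ?M (\<lambda>t. B * norm (v t))"
        using v by auto
      show "(\<lambda>t. sympl_J (v t) \<bullet> w t) \<in> borel_measurable ?M"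
        using Jv w_meas by (intro borel_measurable_inner) auto
      have "norm (sympl_J (v t) \<bullet> w t) \<le> norm (B * norm (v t))" if "t \<in> {0..T}" for t
      proof -
        have "norm (sympl_J (v t) \<bullet> w t) \<le> norm (v t) * norm (w t)"
          using Cauchy_Schwarz_ineq2[of "sympl_J (v t)" "w t"] by (simp add: J_norm)
        also have "\<dots> \<le> norm (v t) * B"
          using B[OF that] by (intro mult_left_mono) auto
        finally show ?thesis
          by (simp add: mult.commute)
      qed
      then show "AE t in ?M. norm (sympl_J (v t) \<bullet> w t) \<le> norm (B * norm (v t))"
        by (intro AE_I2) simp
    qed
    have "(LINT t|?M. v t) = 0"
    proof (rule has_integral_unique)
      show "(v has_integral (LINT t|?M. v t)) {0..T}"
        by (rule has_integral_integral_lebesgue_on[OF v]) simp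
      show "(v has_integral 0) {0..T}"
        using has_integral_time_deriv[OF ac, of T] assms(1) by (simp add: v_def per)
    qed
    \<comment> \<open>The constant part \<open>u 0\<close> pairs to zero with the mean-free
      derivative.\<close>
    then have "(LINT t|?M. v t \<bullet> sympl_J (u 0)) = 0"
      using v by simp
    then have "(LINT t|?M. sympl_J (v t) \<bullet> u 0) = 0"
      by (simp add: inner_sympl_J_left)
    moreover have "(LINT t|?M. sympl_J (v t) \<bullet> u t)
        = (LINT t|?M. sympl_J (v t) \<bullet> w t) + (LINT t|?M. sympl_J (v t) \<bullet> u 0)"
      using Jv Jvw by (subst Bochner_Integration.integral_add[symmetric])
         (auto simp: w_def inner_diff_right)
    ultimately have reduce: "(LINT t|?M. sympl_J (v t) \<bullet> u t) = (LINT t|?M. sympl_J (v t) \<bullet> w t)"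
      by simp
    have "(LINT t|?M. - (K / T) * (G (T *\<^sub>R v t) + G (w t) + C)) \<le> (LINT t|?M. sympl_J (v t) \<bullet> w t)"
    proof (rule integral_mono[OF _ Jvw])
      show "integrable ?M (\<lambda>t. - (K / T) * (G (T *\<^sub>R v t) + G (w t) + C))"
        using Gv Gw by (auto simp: v_def)
      \<comment> \<open>The Young-type bound at \<open>T v\<close> and \<open>w\<close>, divided by
        \<open>T\<close>.\<close>
      show "- (K / T) * (G (T *\<^sub>R v t) + G (w t) + C) \<le> sympl_J (v t) \<bullet> w t" for t
        using KC(3)[of "T *\<^sub>R v t" "w t"] assms(1)
        by (simp add: linear_scale[OF linear_sympl_J] field_simps)
    qed
    also have "(LINT t|?M. - (K / T) * (G (T *\<^sub>R v t) + G (w t) + C))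
        = - (K / T) * (I + (LINT t|?M. G (w t)) + C * T)"
      using Gv Gw space by (simp add: v_def I_def)
    finally have "- (K / T) * (I + (LINT t|?M. G (w t)) + C * T) \<le> (LINT t|?M. sympl_J (v t) \<bullet> w t)" .
    moreover have "(LINT t|?M. G (w t)) \<le> I"
    proof -
      have "(LINT t|?M. G (w t)) \<le> (LINT t|?M. I / T)"
        using w_le by (intro integral_mono Gw) auto
      then show ?thesis
        using space assms(1) by simp
    qed
    then have "(K / T) * (I + (LINT t|?M. G (w t)) + C * T) \<le> (K / T) * (I + I + C * T)"
      using KC(1) assms(1) by (intro mult_left_mono) auto
    ultimately show ?thesis
      using assms(1) reduce by (simp add: v_def[symmetric] I_def[symmetric] algebra_simps)
  qed
  \<comment> \<open>\<open>G (T v)\<close> and \<open>G w\<close> contribute one integral each,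
    hence the factor 2. The added 1 keeps the second constant positive when
    \<open>C = 0\<close>.\<close>
  have "ereal (LINT t|?M. sympl_J (time_deriv T u t) \<bullet> u t)
      \<ge> - (ereal (2 * K / T) * enn2ereal (\<integral>\<^sup>+ t. ennreal (G (T *\<^sub>R time_deriv T u t)) \<partial>?M)) - ereal (K * C + 1)"
    if u: "u \<in> periodic_Orlicz_Sobolev G T" for u
  \<comment> \<open>If the integral is infinite, the positive first constant makes the right side
    minus infinity.\<close>
  proof (cases "(\<integral>\<^sup>+ t. ennreal (G (T *\<^sub>R time_deriv T u t)) \<partial>?M) = \<infinity>")
    case True
    then show ?thesis
      using KC(1) assms(1) by simp
  next
    case False
    have "time_deriv T u \<in> borel_measurable ?M"
      using u by (auto simp: periodic_Orlicz_Sobolev_def Orlicz_space_def)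
    then have meas: "(\<lambda>t. G (T *\<^sub>R time_deriv T u t)) \<in> borel_measurable ?M"
      by (intro measurable_compose[OF _ G_meas]) auto
    have Gv: "integrable ?M (\<lambda>t. G (T *\<^sub>R time_deriv T u t))"
      using False G_facts(2) by (intro integrableI_nonneg meas) (auto simp: less_top)
    have eq: "(\<integral>\<^sup>+ t. ennreal (G (T *\<^sub>R time_deriv T u t)) \<partial>?M)
        = ennreal (LINT t|?M. G (T *\<^sub>R time_deriv T u t))"
      using Gv G_facts(2) by (intro nn_integral_eq_integral) auto
    have "0 \<le> (LINT t|?M. G (T *\<^sub>R time_deriv T u t))"
      using G_facts(2) by (intro integral_nonneg_AE) auto
    then show ?thesis
      using main[OF u Gv] by (simp add: eq enn2ereal_ennreal)
  qed
  moreover have "0 < 2 * K / T" "0 < K * C + 1"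
    using KC(1,2) assms(1) by (auto intro: add_nonneg_pos)
  ultimately show ?thesis
    by blast
qed

end
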